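(* Let $\Phi\in L$, $h\in L^{+}$ and let $\varphi$ be the inverse function to $\Phi$. Let $(n_k)_{k\ge0}$ be a strictly increasing sequence of non-negative integers and let $f(z)=\sum_{k=0}^{+\infty}f_kz^{n_k}$ be an entire function. If there is $r_0$ such that $$\ln\mu_f(r)\ge \ln r\;\Phi(\ln r)\qquad (r\ge r_0)$$ and $$(\forall b>0):\quad \sum_{k=0}^{+\infty}\frac{1}{n_{k+1}-n_k}\,h'\Big(\exp\Big\{\varphi(n_k)+\frac{b}{n_{k+1}-n_k}\Big\}\Big)<+\infty,$$ then there is a set $E_2\subset[1,+\infty)$ of finite $h$-log-measure such that the relation $$f(re^{i\theta})=(1+o(1))\,f_{\nu_f(r)}\,r^{n_{\nu_f(r)}}e^{i\theta n_{\nu_f(r)}}$$ holds as $r\to+\infty$, $r\notin E_2$, uniformly in $\theta\in[0,2\pi]$.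
   Context: $L$ is the class of positive continuous functions on $[0,+\infty)$ increasing to $+\infty$; $L^{+}$ is the subclass of differentiable functions in $L$ with non-decreasing derivative. For $r>0$: $\mu_f(r)=\max\{|f_k|r^{n_k}:k\ge0\}$ is the maximum term of $f$ and $\nu_f(r)=\max\{k:|f_k|r^{n_k}=\mu_f(r)\}$ is the central index. The $h$-log-measure of a measurable set $E\subset[1,+\infty)$ is $\int_E\frac{dh(r)}{r}$. Convention: the finitely many terms of the series for which $\varphi(n_k)$ is not defined (those with $n_k<\Phi(0)$) are disregarded. *)

theory Defs
  imports "HOL-Analysis.Analysis"
begin

text \<open>
  Functions on \<open>[0, \<infinity>)\<close> are total functions on \<open>real\<close> whose values on the negative half-line
  are never used. ``Increasing'' is strict, so that the functions of the class have inverses.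
\<close>

definition class_L :: "(real \<Rightarrow> real) set" where
  "class_L = {\<Phi>. continuous_on {0..} \<Phi> \<and> (\<forall>x\<ge>0. \<Phi> x > 0) \<and>
                 strict_mono_on {0..} \<Phi> \<and> filterlim \<Phi> at_top at_top}"

text \<open>The derivative on \<open>[0, \<infinity>)\<close>; it is one-sided at \<open>0\<close>.\<close>

definition hl_deriv :: "(real \<Rightarrow> real) \<Rightarrow> real \<Rightarrow> real" where
  "hl_deriv h x = vector_derivative h (at x within {0..})"

definition class_Lplus :: "(real \<Rightarrow> real) set" where
  "class_Lplus = {h \<in> class_L. h differentiable_on {0..} \<and> mono_on {0..} (hl_deriv h)}"

text \<open>
  For a power series with coefficients \<open>a k\<close> and exponents \<open>n k\<close>. \<open>Max\<close> is of no use here because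
  the set of terms is in general infinite; \<open>GREATEST\<close> is meaningful whenever the maximum is
  attained, as it is for \<open>r > 0\<close> if the series represents a nonzero entire function.
\<close>

definition max_term :: "(nat \<Rightarrow> complex) \<Rightarrow> (nat \<Rightarrow> nat) \<Rightarrow> real \<Rightarrow> real" where
  "max_term a n r = (GREATEST m. m \<in> range (\<lambda>k. norm (a k) * r ^ n k))"

definition central_index :: "(nat \<Rightarrow> complex) \<Rightarrow> (nat \<Rightarrow> nat) \<Rightarrow> real \<Rightarrow> nat" where
  "central_index a n r = (GREATEST k. norm (a k) * r ^ n k = max_term a n r)"

text \<open>
  The integral of \<open>1 / r\<close> over \<open>E\<close> against the Lebesgue--Stieltjes measure \<open>dh\<close>. As
  \<open>interval_measure\<close> expects a monotone function on the whole line, \<open>h\<close> is extended by the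
  constant \<open>h 0\<close> to the left, where this measure vanishes.
\<close>

definition h_log_measure :: "(real \<Rightarrow> real) \<Rightarrow> real set \<Rightarrow> ennreal" where
  "h_log_measure h E =
     (\<integral>\<^sup>+r\<in>E. ennreal (1 / r) \<partial>interval_measure (\<lambda>x. h (max 0 x)))"

end

theory Submission
  imports Defs
begin

text \<open>
  Fix \<open>b > 0\<close> and put \<open>\<delta>\<^sub>j = b / (n\<^sub>j\<^sub>+\<^sub>1 - n\<^sub>j)\<close>. On the logarithmic scale, two terms of the series whose
  exponents differ by \<open>D\<close> separate at speed \<open>D\<close> as \<open>ln r\<close> moves. Suppose that the central index \<open>\<nu>\<close>
  cannot be pushed past \<open>j\<close> by moving \<open>ln r\<close> a distance \<open>\<delta>\<^sub>j\<close>, upwards for each \<open>j \<ge> \<nu> r\<close> and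
  downwards for each \<open>j < \<nu> r\<close>. Then every step of the index away from \<open>\<nu> r\<close> costs a factor
  \<open>exp (- b)\<close>, so the \<open>k\<close>-th term at \<open>r\<close> is at most \<open>exp (- b \<bar>k - \<nu> r\<bar>)\<close> times the maximum term
  (\<open>term_decay_above\<close>, \<open>term_decay_below\<close>). Summing two geometric series, all the terms other than
  the leading one amount to at most \<open>2 / (exp b - 1)\<close> times the maximum term.

  The points \<open>r\<close> that violate this condition for a given \<open>j\<close> lie close to the place where \<open>\<nu>\<close> jumps
  past \<open>j\<close>: since \<open>\<nu>\<close> is monotone, those violating the upward condition fill a set of logarithmic
  diameter at most \<open>\<delta>\<^sub>j\<close>, and so do those violating the downward one. The growth hypothesis and the
  convexity of \<open>ln \<mu>\<^sub>f\<close> in \<open>ln r\<close> give \<open>\<Phi> (ln r) \<le> n\<^bsub>\<nu> r\<^esub>\<close> for large \<open>r\<close> (\<open>central_exponent_ge\<close>), so these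
  sets lie below \<open>exp (\<phi> n\<^sub>j + \<delta>\<^sub>j)\<close>. By the mean value theorem their \<open>h\<close>-log-measure is then at most
  a constant times \<open>\<delta>\<^sub>j h' (exp (\<phi> n\<^sub>j + \<delta>\<^sub>j))\<close>, the general term of the convergent series of the
  hypothesis. This gives an exceptional set \<open>E\<^sub>b\<close> for each \<open>b\<close> (\<open>exceptional_set\<close>). Letting \<open>b\<close> run
  through the positive integers and discarding from each \<open>E\<^sub>b\<close> a bounded part that leaves at most
  the measure \<open>2\<^sup>1\<^sup>-\<^sup>b\<close>, the union of the remaining tails has finite measure, and
  outside it the relative error tends to \<open>0\<close>.
\<close>

section \<open>Maximum term and central index\<close>

locale gap_series =
  fixes a :: "nat \<Rightarrow> complex" and n :: "nat \<Rightarrow> nat"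
  assumes strict_mono_n: "strict_mono n"
    and terms_tendsto_0: "\<And>r. r > 0 \<Longrightarrow> (\<lambda>k. norm (a k) * r ^ n k) \<longlonglongrightarrow> 0"
    and nonzero: "\<exists>k. a k \<noteq> 0"
begin

abbreviation T :: "nat \<Rightarrow> real \<Rightarrow> real" where
  "T k r \<equiv> norm (a k) * r ^ n k"

abbreviation \<nu> :: "real \<Rightarrow> nat" where
  "\<nu> \<equiv> central_index a n"

lemma finite_large_terms:
  assumes "r > 0" "c > 0"
  shows "finite {k. T k r \<ge> c}"
proof -
  have "\<forall>\<^sub>F k in sequentially. T k r < c"
    using order_tendstoD(2)[OF terms_tendsto_0[OF assms(1)] assms(2)] .
  then obtain K where K: "\<And>k. k \<ge> K \<Longrightarrow> T k r < c"
    unfolding eventually_sequentially by blast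
  have "{k. T k r \<ge> c} \<subseteq> {..<K}"
    using K by (auto simp: not_less[symmetric])
  then show ?thesis
    using finite_subset by blast
qed

lemma max_term_exists:
  assumes "r > 0"
  shows "\<exists>k. T k r > 0 \<and> (\<forall>j. T j r \<le> T k r)"
proof -
  obtain k0 where k0: "a k0 \<noteq> 0" using nonzero by blast
  have pos: "T k0 r > 0" using k0 assms by simp
  let ?A = "{k. T k r \<ge> T k0 r}"
  have fin: "finite ?A" using finite_large_terms[OF assms pos] .
  have "?A \<noteq> {}" by blast
  then have "Max ((\<lambda>k. T k r) ` ?A) \<in> (\<lambda>k. T k r) ` ?A"
    using fin by (intro Max_in) auto
  then obtain k where k: "k \<in> ?A" "T k r = Max ((\<lambda>k. T k r) ` ?A)" by auto
  have "j \<in> ?A \<Longrightarrow> T j r \<le> T k r" for j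
    unfolding k(2) by (rule Max_ge) (use fin in auto)
  note k = k(1) this
  have "T j r \<le> T k r" for j
    using k(1) k(2)[of j] by (cases "j \<in> ?A") auto
  moreover have "T k r > 0" using pos k(1) by simp
  ultimately show ?thesis by blast
qed

lemma central_index:
  assumes "r > 0"
  shows term_le_central: "T k r \<le> T (\<nu> r) r"
    and term_less_central: "k > \<nu> r \<Longrightarrow> T k r < T (\<nu> r) r"
    and central_pos: "T (\<nu> r) r > 0"
    and max_term_eq: "max_term a n r = T (\<nu> r) r"
proof -
  obtain m where m: "T m r > 0" "\<And>j. T j r \<le> T m r"
    using max_term_exists[OF assms] by blast
  have mt: "max_term a n r = T m r"
    unfolding max_term_def by (rule Greatest_equality) (use m in auto)
  let ?P = "\<lambda>k. T k r = max_term a n r"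
  have "finite {k. ?P k}"
    by (rule finite_subset[OF _ finite_large_terms[OF assms m(1)]]) (auto simp: mt)
  then obtain K where K: "\<forall>y. ?P y \<longrightarrow> y \<le> K"
    unfolding finite_nat_set_iff_bounded_le by blast
  have \<nu>: "?P (\<nu> r)"
    unfolding central_index_def by (rule GreatestI_nat[where k = m and b = K]) (use mt K in auto)
  have ge: "?P k \<Longrightarrow> k \<le> \<nu> r" for k
    unfolding central_index_def by (rule Greatest_le_nat[where b = K]) (use K in auto)
  show "max_term a n r = T (\<nu> r) r" "T (\<nu> r) r > 0" using \<nu> mt m by auto
  show le: "T k r \<le> T (\<nu> r) r" for k using m(2) \<nu> mt by simp
  show "T k r < T (\<nu> r) r" if "k > \<nu> r"
    using le[of k] ge[of k] \<nu> that by fastforce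
qed

lemma term_scale: "T k (r * s) = T k r * s ^ n k"
  by (simp add: power_mult_distrib)

lemma central_index_mono:
  assumes "0 < r" "r \<le> s"
  shows "\<nu> r \<le> \<nu> s"
proof (rule ccontr)
  assume "\<not> \<nu> r \<le> \<nu> s"
  then have less: "\<nu> s < \<nu> r" by simp
  define q where "q = s / r"
  have q: "q \<ge> 1" "s = r * q" using assms by (auto simp: q_def)
  have s: "s > 0" using assms by simp
  \<comment> \<open>In passing from \<open>r\<close> to \<open>s\<close> the larger exponent gains more, which contradicts that
    \<open>\<nu> s\<close> is the last index of a maximal term at \<open>s\<close>.\<close>
  have "T (\<nu> s) s = T (\<nu> s) r * q ^ n (\<nu> s)"
    unfolding q(2) by (rule term_scale)
  also have "\<dots> \<le> T (\<nu> r) r * q ^ n (\<nu> r)"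
  proof (rule mult_mono)
    show "q ^ n (\<nu> s) \<le> q ^ n (\<nu> r)"
      using q less strict_mono_n by (intro power_increasing) (auto simp: strict_mono_def less_imp_le)
  qed (use term_le_central[OF assms(1)] assms q in auto)
  also have "\<dots> = T (\<nu> r) s"
    unfolding q(2) by (rule term_scale[symmetric])
  finally show False
    using term_less_central[OF s less] by simp
qed

end

section \<open>Geometric decay away from the central index\<close>

context gap_series
begin

lemma gap_sum_le:
  fixes \<delta> :: "nat \<Rightarrow> real"
  assumes "i \<le> k"
    and "\<And>t. t \<in> {i..<k} \<Longrightarrow> \<delta> t \<le> d"
    and gap: "\<And>t. b \<le> \<delta> t * (real (n (Suc t)) - real (n t))"
  shows "b * (real k - real i) \<le> d * (real (n k) - real (n i))"
  using assms(1,2)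
proof (induction k rule: dec_induct)
  case base
  then show ?case by simp
next
  case (step k)
  have pos: "real (n (Suc k)) - real (n k) \<ge> 0"
    using strict_mono_n by (simp add: strict_mono_Suc_iff less_imp_le)
  have "b \<le> \<delta> k * (real (n (Suc k)) - real (n k))" by (rule gap)
  also have "\<dots> \<le> d * (real (n (Suc k)) - real (n k))"
    using step.prems[of k] step.hyps pos by (intro mult_right_mono) auto
  finally have "b \<le> d * (real (n (Suc k)) - real (n k))" .
  moreover have "b * (real k - real i) \<le> d * (real (n k) - real (n i))"
    using step by auto
  ultimately show ?case by (simp add: algebra_simps)
qed

lemma maximal_index:
  fixes \<delta> :: "nat \<Rightarrow> real"
  assumes "m < k"
  obtains j where "m \<le> j" "j < k" "\<And>t. t \<in> {m..<k} \<Longrightarrow> \<delta> t \<le> \<delta> j"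
proof -
  have "Max (\<delta> ` {m..<k}) \<in> \<delta> ` {m..<k}"
    using assms by (intro Max_in) auto
  then obtain j where j: "j \<in> {m..<k}" "\<delta> j = Max (\<delta> ` {m..<k})" by auto
  show ?thesis
    by (rule that[of j]) (use j in \<open>auto simp: Max_ge\<close>)
qed

text \<open>
  A comparison of two terms at the shifted point \<open>r exp d\<close> improves at \<open>r\<close> itself by the
  \<open>(n k - n i)\<close>-th power of the shift; \<open>d\<close> may have either sign.
\<close>

lemma term_le_of_shifted_le:
  assumes "0 < r" "T k (r * exp d) \<le> T i (r * exp d)"
    and "b * c \<le> d * (real (n k) - real (n i))"
  shows "T k r \<le> exp (- b * c) * T i r"
proof -
  have e: "exp d ^ n j = exp (d * real (n j))" for j
    by (simp add: exp_of_nat2_mult)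
  have "T k r * exp (d * real (n k)) \<le> T i r * exp (d * real (n i))"
    using assms(2) unfolding term_scale e .
  then have "T k r \<le> T i r * (exp (d * real (n i)) / exp (d * real (n k)))"
    by (simp add: field_simps)
  also have "exp (d * real (n i)) / exp (d * real (n k)) = exp (- (d * (real (n k) - real (n i))))"
    unfolding exp_diff[symmetric] by (simp add: algebra_simps)
  also have "T i r * \<dots> \<le> T i r * exp (- b * c)"
    using assms by (intro mult_left_mono) auto
  finally show ?thesis by (simp add: mult.commute)
qed

text \<open>
  Induction on \<open>k\<close>: among \<open>\<nu> r \<le> j < k\<close> take the \<open>j\<close> with the largest shift \<open>\<delta> j\<close>. After this shift the
  maximum term has an index \<open>i \<le> j < k\<close>, and going back to \<open>r\<close> yields the factor
  \<open>exp (- \<delta> j (n k - n i))\<close>. As \<open>\<delta> j\<close> dominates every \<open>\<delta> t\<close> with \<open>i \<le> t < k\<close>, the exponent is at least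
  \<open>b (k - i)\<close>, and the induction hypothesis covers the remaining way from \<open>i\<close> to \<open>\<nu> r\<close>. For
  another \<open>j\<close> the shift might be too small for the narrow gaps between \<open>i\<close> and \<open>k\<close>.
\<close>

lemma term_decay_above:
  fixes \<delta> :: "nat \<Rightarrow> real"
  assumes r: "r > 0"
    and gap: "\<And>t. b \<le> \<delta> t * (real (n (Suc t)) - real (n t))"
    and nonneg: "\<And>t. \<delta> t \<ge> 0"
    and stable: "\<And>j. j \<ge> \<nu> r \<Longrightarrow> \<nu> (r * exp (\<delta> j)) \<le> j"
    and "k \<ge> \<nu> r"
  shows "T k r \<le> exp (- b * (real k - real (\<nu> r))) * T (\<nu> r) r"
  using \<open>k \<ge> \<nu> r\<close>
proof (induction k rule: less_induct)
  case (less k)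
  show ?case
  proof (cases "k = \<nu> r")
    case True
    then show ?thesis by simp
  next
    case False
    then have "\<nu> r < k" using less.prems by simp
    then obtain j where j: "\<nu> r \<le> j" "j < k" "\<And>t. t \<in> {\<nu> r..<k} \<Longrightarrow> \<delta> t \<le> \<delta> j"
      using maximal_index by metis
    define i where "i = \<nu> (r * exp (\<delta> j))"
    have "i \<le> j" using stable[OF j(1)] by (simp add: i_def)
    have "\<nu> r \<le> i"
      unfolding i_def using r nonneg[of j] by (intro central_index_mono) auto
    have "b * (real k - real i) \<le> \<delta> j * (real (n k) - real (n i))"
      by (rule gap_sum_le[of i k \<delta>]) (use \<open>i \<le> j\<close> \<open>\<nu> r \<le> i\<close> j gap in auto)
    then have "T k r \<le> exp (- b * (real k - real i)) * T i r"
      using r by (intro term_le_of_shifted_le[where d = "\<delta> j"]) (auto simp: i_def intro!: term_le_central)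
    also have "\<dots> \<le> exp (- b * (real k - real i)) * (exp (- b * (real i - real (\<nu> r))) * T (\<nu> r) r)"
      using less.IH[of i] \<open>i \<le> j\<close> j(2) \<open>\<nu> r \<le> i\<close> by (intro mult_left_mono) auto
    also have "\<dots> = exp (- b * (real k - real (\<nu> r))) * T (\<nu> r) r"
      unfolding mult.assoc[symmetric] mult_exp_exp distrib_left[symmetric] by simp
    finally show ?thesis .
  qed
qed

text \<open>
  The mirror image of the previous argument: the shift is downwards and the index \<open>i\<close> of the
  maximum term at the shifted point satisfies \<open>k \<le> j < i \<le> \<nu> r\<close>.
\<close>

lemma term_decay_below:
  fixes \<delta> :: "nat \<Rightarrow> real"
  assumes r: "r > 0"
    and gap: "\<And>t. b \<le> \<delta> t * (real (n (Suc t)) - real (n t))"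
    and nonneg: "\<And>t. \<delta> t \<ge> 0"
    and stable: "\<And>j. j < \<nu> r \<Longrightarrow> j < \<nu> (r * exp (- \<delta> j))"
    and "k \<le> \<nu> r"
  shows "T k r \<le> exp (- b * (real (\<nu> r) - real k)) * T (\<nu> r) r"
  using \<open>k \<le> \<nu> r\<close>
proof (induction "\<nu> r - k" arbitrary: k rule: less_induct)
  case (less k)
  show ?case
  proof (cases "k = \<nu> r")
    case True
    then show ?thesis by simp
  next
    case False
    then have "k < \<nu> r" using less.prems by simp
    then obtain j where j: "k \<le> j" "j < \<nu> r" "\<And>t. t \<in> {k..<\<nu> r} \<Longrightarrow> \<delta> t \<le> \<delta> j"
      using maximal_index by metis
    define i where "i = \<nu> (r * exp (- \<delta> j))"
    have "j < i" using stable[OF j(2)] by (simp add: i_def)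
    have "i \<le> \<nu> r"
      unfolding i_def using r nonneg[of j] by (intro central_index_mono) auto
    have "b * (real i - real k) \<le> \<delta> j * (real (n i) - real (n k))"
      by (rule gap_sum_le[of k i \<delta>]) (use \<open>j < i\<close> \<open>i \<le> \<nu> r\<close> j gap in auto)
    then have "T k r \<le> exp (- b * (real i - real k)) * T i r"
      using r term_le_central[of "r * exp (- \<delta> j)" k]
      by (intro term_le_of_shifted_le[where d = "- \<delta> j"]) (simp_all add: i_def algebra_simps)
    also have "\<dots> \<le> exp (- b * (real i - real k)) * (exp (- b * (real (\<nu> r) - real i)) * T (\<nu> r) r)"
      using less.hyps[of i] \<open>j < i\<close> j(1,2) \<open>i \<le> \<nu> r\<close> by (intro mult_left_mono) auto
    also have "\<dots> = exp (- b * (real (\<nu> r) - real k)) * T (\<nu> r) r"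
      unfolding mult.assoc[symmetric] mult_exp_exp distrib_left[symmetric] by simp
    finally show ?thesis .
  qed
qed

end

lemma sums_two_sided_geometric_le:
  fixes u :: "nat \<Rightarrow> complex" and q M :: real
  assumes q: "0 < q" "q < 1" and "M \<ge> 0"
    and sums: "u sums s"
    and above: "\<And>k. k > m \<Longrightarrow> norm (u k) \<le> q ^ (k - m) * M"
    and below: "\<And>k. k < m \<Longrightarrow> norm (u k) \<le> q ^ (m - k) * M"
  shows "norm (s - u m) \<le> 2 * (q / (1 - q) * M)"
proof -
  have g: "(\<lambda>k. q ^ Suc k * M) sums (q / (1 - q) * M)"
    using sums_mult2[OF sums_mult[OF geometric_sums[of q], of q], of M] q by simp
  have tail: "(\<lambda>k. u (k + Suc m)) sums (s - (\<Sum>k<Suc m. u k))"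
    using sums_split_initial_segment[OF sums, of "Suc m"] .
  have "norm (s - (\<Sum>k<Suc m. u k)) \<le> q / (1 - q) * M"
  proof -
    have "norm (u (k + Suc m)) \<le> q ^ Suc k * M" for k
      using above[of "k + Suc m"] by simp
    then show ?thesis
      using norm_sums_le[OF tail g] by blast
  qed
  moreover have "norm (\<Sum>k<m. u k) \<le> q / (1 - q) * M"
  proof -
    have "norm (\<Sum>k<m. u k) \<le> (\<Sum>k<m. q ^ (m - k) * M)"
      using below by (intro sum_norm_le) auto
    also have "\<dots> = (\<Sum>k<m. q ^ Suc k * M)"
      by (rule sum.reindex_bij_witness[of _ "\<lambda>k. m - Suc k" "\<lambda>k. m - Suc k"]) (auto simp: Suc_diff_Suc)
    also have "\<dots> \<le> (\<Sum>k. q ^ Suc k * M)"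
      using sums_summable[OF g] q assms(3) by (intro sum_le_suminf) auto
    finally show ?thesis unfolding sums_unique[OF g] .
  qed
  moreover have "norm (s - u m) \<le> norm (s - (\<Sum>k<Suc m. u k)) + norm (\<Sum>k<m. u k)"
    using norm_triangle_ineq[of "s - (\<Sum>k<Suc m. u k)" "\<Sum>k<m. u k"] by simp
  ultimately show ?thesis by argo
qed

section \<open>Estimates of the h-log-measure\<close>

lemma h_log_measure_eq_emeasure:
  assumes "E \<in> sets borel"
  shows "h_log_measure h E =
    emeasure (density (interval_measure (\<lambda>x. h (max 0 x))) (\<lambda>r. ennreal (1 / r))) E"
  unfolding h_log_measure_def using assms by (subst emeasure_density) auto

lemma Lplus_increment_le:
  assumes h: "h \<in> class_Lplus" and "0 \<le> s" "s \<le> t"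
  shows "h t - h s \<le> (t - s) * hl_deriv h t"
proof -
  have "(h has_derivative (\<lambda>y. y *\<^sub>R hl_deriv h x)) (at x within {s..t})" if "s \<le> x" "x \<le> t" for x
  proof -
    have "h differentiable (at x within {0..})"
      using h that assms(2) by (auto simp: class_Lplus_def differentiable_on_def)
    then have "(h has_vector_derivative hl_deriv h x) (at x within {0..})"
      unfolding hl_deriv_def by (simp add: vector_derivative_works)
    then show ?thesis
      unfolding has_vector_derivative_def
      by (rule has_derivative_subset) (use assms(2) in auto)
  qed
  from mvt_very_simple[OF assms(3) this] obtain x
    where x: "x \<in> {s..t}" "h t - h s = (t - s) *\<^sub>R hl_deriv h x" by blast
  have "hl_deriv h x \<le> hl_deriv h t"
    using h x(1) assms(2) unfolding class_Lplus_def by (auto intro: mono_onD)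
  then show ?thesis
    using x(2) assms(3) by (simp add: mult_left_mono)
qed

lemma Lplus_deriv_pos:
  assumes h: "h \<in> class_Lplus" and "0 < t"
  shows "0 < hl_deriv h t"
proof -
  have "h 0 < h t"
    using h assms(2) by (auto simp: class_Lplus_def class_L_def intro: strict_mono_onD)
  then have "0 < t * hl_deriv h t"
    using Lplus_increment_le[OF h, of 0 t] assms(2) by simp
  then show ?thesis using assms(2) by (simp add: zero_less_mult_iff)
qed

lemma h_log_measure_interval_le:
  assumes h: "h \<in> class_Lplus" and st: "1 \<le> s" "s \<le> t"
  shows "h_log_measure h {s..t} \<le> ennreal ((t / s - 1) * hl_deriv h t)"
proof -
  let ?F = "\<lambda>x. h (max 0 x)"
  have hL: "continuous_on {0..} h" "strict_mono_on {0..} h"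
    using h by (auto simp: class_Lplus_def class_L_def)
  have cont: "continuous_on UNIV ?F"
    by (rule continuous_on_compose2[OF hL(1)]) (auto intro!: continuous_intros)
  have mono: "?F x \<le> ?F y" if "x \<le> y" for x y
    using strict_mono_on_leD[OF hL(2), of "max 0 x" "max 0 y"] that by auto
  have meas: "emeasure (interval_measure ?F) {s..t} = ennreal (h t - h s)"
    using emeasure_interval_measure_Icc[OF st(2), of ?F] cont mono st by simp
  have "h_log_measure h {s..t} \<le> (\<integral>\<^sup>+r\<in>{s..t}. ennreal (1 / s) \<partial>interval_measure ?F)"
    unfolding h_log_measure_def using st
    by (intro nn_integral_mono) (auto simp: indicator_def intro!: ennreal_leI divide_left_mono)
  also have "\<dots> = ennreal (1 / s) * ennreal (h t - h s)"
    by (simp add: nn_integral_cmult_indicator meas)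
  also have "\<dots> = ennreal (1 / s * (h t - h s))"
    using st by (simp add: ennreal_mult'[symmetric])
  also have "\<dots> \<le> ennreal (1 / s * ((t - s) * hl_deriv h t))"
    using Lplus_increment_le[OF h, of s t] st by (intro ennreal_leI mult_left_mono) auto
  also have "1 / s * ((t - s) * hl_deriv h t) = (t / s - 1) * hl_deriv h t"
    using st by (simp add: field_simps)
  finally show ?thesis .
qed

text \<open>
  The closed interval from \<open>Inf B\<close> to \<open>Sup B\<close> does it, as the ratio of its end points is still at
  most \<open>exp d\<close>. Covering \<open>B\<close> by an interval spares a discussion of its measurability.
\<close>

lemma small_log_diameter_cover:
  assumes h: "h \<in> class_Lplus" and "B \<subseteq> {1..}"
    and ratio: "\<And>x y. x \<in> B \<Longrightarrow> y \<in> B \<Longrightarrow> y \<le> x * exp d"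
    and bound: "\<And>x. x \<in> B \<Longrightarrow> x \<le> U"
  shows "\<exists>C\<in>sets borel. B \<subseteq> C \<and> C \<subseteq> {1..} \<and>
    h_log_measure h C \<le> ennreal ((exp d - 1) * hl_deriv h U)"
proof (cases "B = {}")
  case True
  then show ?thesis
    by (intro bexI[of _ "{}"]) (auto simp: h_log_measure_def)
next
  case False
  define s t where "s = Inf B" and "t = Sup B"
  have bdd: "bdd_below B" "bdd_above B"
    using assms(2) bound by (auto intro: bdd_belowI[of _ 1] bdd_aboveI[of _ U])
  have B: "B \<subseteq> {s..t}"
    using bdd by (auto simp: s_def t_def intro: cInf_lower cSup_upper)
  have s: "1 \<le> s" unfolding s_def using assms(2) False by (intro cInf_greatest) auto
  have st: "s \<le> t" using B False by auto
  have tU: "t \<le> U" unfolding t_def using bound False by (intro cSup_least) auto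
  have "t * exp (- d) \<le> s"
    unfolding s_def
  proof (rule cInf_greatest[OF False])
    fix x assume "x \<in> B"
    then have "t \<le> x * exp d"
      unfolding t_def using ratio False by (intro cSup_least) auto
    then show "t * exp (- d) \<le> x" by (simp add: exp_minus field_simps)
  qed
  then have "t / s \<le> exp d"
    using s by (simp add: exp_minus field_simps)
  moreover have "hl_deriv h t \<le> hl_deriv h U"
    using h tU s st unfolding class_Lplus_def by (auto intro: mono_onD)
  moreover have "0 \<le> hl_deriv h t"
    using Lplus_deriv_pos[OF h, of t] s st by simp
  moreover have ts: "1 \<le> t / s" using s st by simp
  moreover have "0 \<le> d"
    using order_trans[OF ts \<open>t / s \<le> exp d\<close>] by simp
  ultimately have "(t / s - 1) * hl_deriv h t \<le> (exp d - 1) * hl_deriv h U"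
    by (intro mult_mono) auto
  then have "h_log_measure h {s..t} \<le> ennreal ((exp d - 1) * hl_deriv h U)"
    using h_log_measure_interval_le[OF h s st] by (meson ennreal_leI order_trans)
  then show ?thesis using B s by (intro bexI[of _ "{s..t}"]) auto
qed

lemma summable_covers:
  assumes "summable G" and "\<And>j. 0 \<le> G j"
    and cover: "\<And>j::nat. \<exists>C\<in>sets borel. B j \<subseteq> C \<and> C \<subseteq> {1..} \<and> h_log_measure h C \<le> ennreal (G j)"
  shows "\<exists>C\<in>sets borel. (\<Union>j. B j) \<subseteq> C \<and> C \<subseteq> {1..} \<and> h_log_measure h C < \<infinity>"
proof -
  let ?M = "density (interval_measure (\<lambda>x. h (max 0 x))) (\<lambda>r. ennreal (1 / r))"
  obtain C where C: "\<And>j. C j \<in> sets borel" "\<And>j. B j \<subseteq> C j" "\<And>j. C j \<subseteq> {1..}"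
      "\<And>j. h_log_measure h (C j) \<le> ennreal (G j)"
    using cover by metis
  have "emeasure ?M (\<Union>j. C j) \<le> (\<Sum>j. emeasure ?M (C j))"
    using C(1) by (intro emeasure_subadditive_countably) auto
  also have "\<dots> \<le> (\<Sum>j. ennreal (G j))"
    using C(1,4) by (intro suminf_le) (auto simp: h_log_measure_eq_emeasure)
  also have "\<dots> = ennreal (\<Sum>j. G j)"
    using assms(1,2) by (intro suminf_ennreal2) auto
  also have "\<dots> < \<infinity>" by simp
  finally have "h_log_measure h (\<Union>j. C j) < \<infinity>"
    using C(1) by (subst h_log_measure_eq_emeasure) auto
  moreover have "(\<Union>j. B j) \<subseteq> (\<Union>j. C j)" "(\<Union>j. C j) \<subseteq> {1..}"
    using C(2,3) by blast+
  ultimately show ?thesis using C(1) by (intro bexI[of _ "\<Union>j. C j"]) auto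
qed

text \<open>
  By continuity from above, a set of finite measure has tails of arbitrarily small measure, so the
  \<open>N\<close>-th set can be cut off where at most \<open>2\<^sup>-\<^sup>N\<close> of it is left.
\<close>

lemma union_of_tails_finite_measure:
  fixes M :: "real measure" and E :: "nat \<Rightarrow> real set" and R0 :: "nat \<Rightarrow> real"
  assumes sets: "sets M = sets borel" and E: "\<And>N. E N \<in> sets borel"
    and fin: "\<And>N. emeasure M (E N) < \<infinity>"
  shows "\<exists>R. (\<forall>N. R0 N \<le> R N) \<and> emeasure M (\<Union>N. E N \<inter> {R N..}) < \<infinity>"
proof -
  have "\<exists>R\<ge>R0 N. emeasure M (E N \<inter> {R..}) \<le> ennreal ((1 / 2) ^ N)" for N
  proof -
    let ?A = "\<lambda>i. E N \<inter> {real i..}"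
    have "(\<lambda>i. emeasure M (?A i)) \<longlonglongrightarrow> emeasure M (\<Inter>i. ?A i)"
    proof (rule Lim_emeasure_decseq)
      show "emeasure M (?A i) \<noteq> \<infinity>" for i
        using fin[of N] emeasure_mono[of "?A i" "E N" M] E[of N] sets by fastforce
    qed (use E sets in \<open>auto simp: decseq_def\<close>)
    also have "(\<Inter>i. ?A i) = {}"
    proof -
      have "\<exists>i. \<not> real i \<le> x" for x
        using reals_Archimedean2[of x] by (auto simp: not_le)
      then show ?thesis by auto
    qed
    finally have "(\<lambda>i. emeasure M (?A i)) \<longlonglongrightarrow> 0" by simp
    then have "\<forall>\<^sub>F i in sequentially. emeasure M (?A i) < ennreal ((1 / 2) ^ N)"
      by (rule order_tendstoD) simp
    moreover have "\<forall>\<^sub>F i in sequentially. R0 N \<le> real i"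
      using filterlim_real_sequentially by (simp add: filterlim_at_top)
    ultimately have "\<forall>\<^sub>F i in sequentially. R0 N \<le> real i \<and> emeasure M (?A i) < ennreal ((1 / 2) ^ N)"
      by eventually_elim auto
    from eventually_happens[OF this] show ?thesis
      by (auto intro: less_imp_le)
  qed
  then obtain R where R: "\<And>N. R0 N \<le> R N"
      "\<And>N. emeasure M (E N \<inter> {R N..}) \<le> ennreal ((1 / 2) ^ N)"
    by metis
  have "emeasure M (\<Union>N. E N \<inter> {R N..}) \<le> (\<Sum>N. emeasure M (E N \<inter> {R N..}))"
    using E sets by (intro emeasure_subadditive_countably) auto
  also have "\<dots> \<le> (\<Sum>N. ennreal ((1 / 2) ^ N))"
    using R(2) by (intro suminf_le) auto
  also have "\<dots> = ennreal (\<Sum>N. (1 / 2) ^ N)"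
    by (intro suminf_ennreal2) (auto intro: summable_geometric)
  also have "\<dots> < \<infinity>" by simp
  finally show ?thesis using R(1) by blast
qed

section \<open>The exceptional set for a fixed rate of decay\<close>

lemma le_inverse_of_class_L:
  assumes "\<Phi> \<in> class_L" and inverse: "\<forall>x\<ge>0. \<phi> (\<Phi> x) = x"
    and "0 \<le> x" "\<Phi> x \<le> y"
  shows "\<Phi> 0 \<le> y" "x \<le> \<phi> y"
proof -
  have \<Phi>: "continuous_on {0..} \<Phi>" "strict_mono_on {0..} \<Phi>" "filterlim \<Phi> at_top at_top"
    using assms(1) by (auto simp: class_L_def)
  show "\<Phi> 0 \<le> y"
    using strict_mono_on_leD[OF \<Phi>(2), of 0 x] assms(3,4) by auto
  have "\<forall>\<^sub>F z in at_top. y \<le> \<Phi> z \<and> x \<le> z"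
    using \<Phi>(3) by (auto simp: filterlim_at_top intro: eventually_conj eventually_ge_at_top)
  then obtain z where z: "y \<le> \<Phi> z" "x \<le> z"
    using eventually_happens[of _ "at_top :: real filter"] by auto
  have "continuous_on {x..z} \<Phi>"
    by (rule continuous_on_subset[OF \<Phi>(1)]) (use assms(3) in auto)
  then obtain w where "x \<le> w" "\<Phi> w = y"
    using IVT'[of \<Phi> x y z] assms(4) z by auto
  then show "x \<le> \<phi> y" using inverse assms(3) by auto
qed

context gap_series
begin

text \<open>
  The central exponent is the slope of the convex function \<open>ln \<mu>\<^sub>f\<close> of \<open>ln r\<close>. Hence, with \<open>r\<^sub>1\<close> fixed,
  \<open>ln \<mu>\<^sub>f(r) \<le> C + n\<^bsub>\<nu> r\<^esub> (ln r - ln r\<^sub>1)\<close>. If \<open>n\<^bsub>\<nu> r\<^esub> < \<Phi> (ln r)\<close>, this and the lower bound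
  \<open>ln r \<Phi> (ln r)\<close> would force \<open>\<Phi> (ln r) ln r\<^sub>1 \<le> C\<close>, which fails for large \<open>r\<close> as soon as \<open>ln r\<^sub>1 > 0\<close>.
\<close>

lemma central_exponent_ge:
  assumes \<Phi>: "\<Phi> \<in> class_L"
    and growth: "\<exists>r0\<ge>1. \<forall>r\<ge>r0. ln (max_term a n r) \<ge> ln r * \<Phi> (ln r)"
  shows "\<exists>R\<ge>1. \<forall>r\<ge>R. \<Phi> (ln r) \<le> real (n (\<nu> r))"
proof -
  obtain r0 where r0: "r0 \<ge> 1" "\<And>r. r \<ge> r0 \<Longrightarrow> ln (max_term a n r) \<ge> ln r * \<Phi> (ln r)"
    using growth by blast
  \<comment> \<open>The maximum with \<open>exp 1\<close> makes \<open>ln r1\<close> positive.\<close>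
  define r1 where "r1 = max r0 (exp 1)"
  define C where "C = ln (T (\<nu> r1) r1)"
  have r1: "r1 \<ge> r0" "r1 \<ge> 1" "ln r1 \<ge> 1" "r1 > 0"
    using r0(1) by (auto simp: r1_def ln_ge_iff)
  have "filterlim (\<lambda>r. \<Phi> (ln r)) at_top at_top"
    using \<Phi> by (intro filterlim_compose[OF _ ln_at_top]) (auto simp: class_L_def)
  then have "\<forall>\<^sub>F r in at_top. C / ln r1 < \<Phi> (ln r)"
    by (simp add: filterlim_at_top_dense)
  then obtain r2 where r2: "\<And>r. r \<ge> r2 \<Longrightarrow> C / ln r1 < \<Phi> (ln r)"
    by (auto simp: eventually_at_top_linorder)
  have "\<Phi> (ln r) \<le> real (n (\<nu> r))" if r: "r \<ge> max r1 r2" for r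
  proof (rule ccontr)
    assume "\<not> ?thesis"
    then have less: "real (n (\<nu> r)) < \<Phi> (ln r)" by simp
    have pos: "r > 0" "ln r \<ge> ln r1" using r r1 by auto
    have "T (\<nu> r) r = T (\<nu> r) r1 * (r / r1) ^ n (\<nu> r)"
      using r1 term_scale[of "\<nu> r" r1 "r / r1"] by simp
    also have "\<dots> \<le> T (\<nu> r1) r1 * (r / r1) ^ n (\<nu> r)"
      using r1 pos by (intro mult_right_mono term_le_central) auto
    finally have "ln (T (\<nu> r) r) \<le> ln (T (\<nu> r1) r1 * (r / r1) ^ n (\<nu> r))"
      using central_pos[OF pos(1)] by simp
    also have "\<dots> = C + real (n (\<nu> r)) * (ln r - ln r1)"
      unfolding C_def using central_pos[OF r1(4)] pos(1) r1(4)
      by (subst ln_mult_pos) (auto simp: ln_realpow ln_div)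
    also have "\<dots> \<le> C + \<Phi> (ln r) * (ln r - ln r1)"
      using less pos by (intro add_left_mono mult_right_mono) auto
    finally have "ln r * \<Phi> (ln r) \<le> C + \<Phi> (ln r) * (ln r - ln r1)"
      using r0(2)[of r] r r1 max_term_eq[OF pos(1)] by simp
    then have "\<Phi> (ln r) * ln r1 \<le> C" by (simp add: algebra_simps)
    moreover have "C < \<Phi> (ln r) * ln r1"
      using r2[of r] r r1(3) by (simp add: pos_divide_less_eq)
    ultimately show False by simp
  qed
  moreover have "max r1 r2 \<ge> 1" using r1 by simp
  ultimately show ?thesis by blast
qed

text \<open>
  The exceptional set covers the points at which the hypothesis of \<open>term_decay_above\<close> or of
  \<open>term_decay_below\<close> fails for some \<open>j\<close>.
\<close>

lemma exceptional_set:
  assumes \<Phi>: "\<Phi> \<in> class_L" and h: "h \<in> class_Lplus"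
    and inverse: "\<forall>x\<ge>0. \<phi> (\<Phi> x) = x"
    and growth: "\<exists>r0\<ge>1. \<forall>r\<ge>r0. ln (max_term a n r) \<ge> ln r * \<Phi> (ln r)"
    and b: "b > 0"
    and gaps: "summable (\<lambda>k.
      if \<Phi> 0 \<le> real (n k)
      then 1 / (real (n (Suc k)) - real (n k)) *
           hl_deriv h (exp (\<phi> (real (n k)) + b / (real (n (Suc k)) - real (n k))))
      else 0)"
  shows "\<exists>E R. E \<in> sets borel \<and> E \<subseteq> {1..} \<and> h_log_measure h E < \<infinity> \<and> 1 \<le> R \<and>
    (\<forall>r\<ge>R. r \<notin> E \<longrightarrow>
      (\<forall>k>\<nu> r. T k r \<le> exp (- b) ^ (k - \<nu> r) * T (\<nu> r) r) \<and>
      (\<forall>k<\<nu> r. T k r \<le> exp (- b) ^ (\<nu> r - k) * T (\<nu> r) r))"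
proof -
  define \<delta> where "\<delta> j = b / (real (n (Suc j)) - real (n j))" for j
  have gap_ge_1: "real (n (Suc j)) - real (n j) \<ge> 1" for j
  proof -
    have "n j < n (Suc j)" using strict_mono_n by (simp add: strict_mono_Suc_iff)
    then show ?thesis by linarith
  qed
  have \<delta>: "0 \<le> \<delta> j" "\<delta> j \<le> b" "\<delta> j * (real (n (Suc j)) - real (n j)) = b" for j
    using gap_ge_1[of j] b by (auto simp: \<delta>_def divide_le_eq)
  obtain R0 where R0: "R0 \<ge> 1" "\<And>r. r \<ge> R0 \<Longrightarrow> \<Phi> (ln r) \<le> real (n (\<nu> r))"
    using central_exponent_ge[OF \<Phi> growth] by blast
  \<comment> \<open>A downward shift of \<open>ln r\<close> by \<open>\<delta> j \<le> b\<close> must stay in the range where the bound on the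
    central exponent is available.\<close>
  define R where "R = R0 * exp b"
  have R: "R \<ge> R0" "R \<ge> 1"
    using R0(1) b mult_mono[of 1 R0 1 "exp b"] by (auto simp: R_def)
  define U where "U j = exp (\<phi> (real (n j)) + \<delta> j)" for j
  \<comment> \<open>\<open>U j\<close> bounds the points to be covered on account of \<open>j\<close>, and \<open>G j\<close> the measure of their cover.
    If \<open>n j\<close> lies below the values of \<open>\<Phi>\<close>, there will be no such points.\<close>
  define G where "G j = (if \<Phi> 0 \<le> real (n j) then (exp (\<delta> j) - 1) * hl_deriv h (U j) else 0)" for j
  have U: "\<Phi> 0 \<le> real (n j)" "r * exp (\<delta> j) \<le> U j" if "r \<ge> R0" "\<nu> r \<le> j" for r j
  proof -
    have "\<Phi> (ln r) \<le> real (n (\<nu> r))" using R0(2) that(1) .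
    also have "\<dots> \<le> real (n j)"
      using strict_mono_n that(2) by (simp add: strict_mono_less_eq)
    finally have *: "\<Phi> (ln r) \<le> real (n j)" .
    have r: "r \<ge> 1" using that(1) R0(1) by simp
    then have "0 \<le> ln r" by simp
    note le = le_inverse_of_class_L[OF \<Phi> inverse this *]
    show "\<Phi> 0 \<le> real (n j)" by (rule le(1))
    have "exp (ln r) \<le> exp (\<phi> (real (n j)))" using le(2) by simp
    then show "r * exp (\<delta> j) \<le> U j" using r by (simp add: U_def exp_add)
  qed
  have G_nonneg: "0 \<le> G j" for j
    using \<delta>(1)[of j] Lplus_deriv_pos[OF h, of "U j"] by (simp add: G_def U_def)
  have "summable G"
  proof (rule summable_comparison_test')
    show "summable (\<lambda>k. b * exp b * (
      if \<Phi> 0 \<le> real (n k)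
      then 1 / (real (n (Suc k)) - real (n k)) *
           hl_deriv h (exp (\<phi> (real (n k)) + b / (real (n (Suc k)) - real (n k))))
      else 0))"
      using gaps by (rule summable_mult)
    fix j :: nat assume "0 \<le> j"
    have "exp (\<delta> j) - 1 \<le> \<delta> j * exp (\<delta> j)"
      using exp_ge_add_one_self[of "- \<delta> j"] by (simp add: exp_minus field_simps)
    also have "\<dots> \<le> \<delta> j * exp b"
      using \<delta>(1,2) by (intro mult_left_mono) auto
    finally have "exp (\<delta> j) - 1 \<le> b * exp b * (1 / (real (n (Suc j)) - real (n j)))"
      by (simp add: \<delta>_def)
    then have "(exp (\<delta> j) - 1) * hl_deriv h (U j) \<le>
        b * exp b * (1 / (real (n (Suc j)) - real (n j))) * hl_deriv h (U j)"
      using Lplus_deriv_pos[OF h, of "U j"] by (intro mult_right_mono) (auto simp: U_def)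
    then show "norm (G j) \<le> b * exp b * (
      if \<Phi> 0 \<le> real (n j)
      then 1 / (real (n (Suc j)) - real (n j)) *
           hl_deriv h (exp (\<phi> (real (n j)) + b / (real (n (Suc j)) - real (n j))))
      else 0)"
      using G_nonneg[of j] by (simp add: G_def U_def \<delta>_def)
  qed
  have cover: "\<exists>C\<in>sets borel. B \<subseteq> C \<and> C \<subseteq> {1..} \<and> h_log_measure h C \<le> ennreal (G j)"
    if "B \<subseteq> {R..}" "\<And>x y. x \<in> B \<Longrightarrow> y \<in> B \<Longrightarrow> y \<le> x * exp (\<delta> j)"
      and "\<And>x. x \<in> B \<Longrightarrow> \<Phi> 0 \<le> real (n j) \<and> x \<le> U j" for B j
  proof (cases "\<Phi> 0 \<le> real (n j)")
    case True
    have "B \<subseteq> {1..}" using that(1) R(2) by auto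
    from small_log_diameter_cover[OF h this that(2)] that(3) True show ?thesis
      unfolding G_def by simp
  next
    case False
    then have "B = {}" using that(3) by blast
    then show ?thesis by (intro bexI[of _ "{}"]) (auto simp: h_log_measure_def)
  qed
  define B1 where "B1 j = {r. R \<le> r \<and> \<nu> r \<le> j \<and> j < \<nu> (r * exp (\<delta> j))}" for j
  define B2 where "B2 j = {r. R \<le> r \<and> \<nu> (r * exp (- \<delta> j)) \<le> j \<and> j < \<nu> r}" for j
  have less: "r < s" if "\<nu> r \<le> j" "j < \<nu> s" "s > 0" for r s j
    using central_index_mono[of s r] that by (meson leI le_less_trans not_less)
  have "\<exists>C\<in>sets borel. (\<Union>j. B1 j) \<subseteq> C \<and> C \<subseteq> {1..} \<and> h_log_measure h C < \<infinity>"
  proof (rule summable_covers[OF \<open>summable G\<close> G_nonneg], rule cover)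
    fix j show "B1 j \<subseteq> {R..}" by (auto simp: B1_def)
    show "y \<le> x * exp (\<delta> j)" if "x \<in> B1 j" "y \<in> B1 j" for x y
      using less[of y j "x * exp (\<delta> j)"] that R by (auto simp: B1_def)
    show "\<Phi> 0 \<le> real (n j) \<and> x \<le> U j" if "x \<in> B1 j" for x
    proof -
      have x: "x \<ge> R0" "x \<ge> 1" "\<nu> x \<le> j" using that R by (auto simp: B1_def)
      have "x * 1 \<le> x * exp (\<delta> j)"
        using x \<delta>(1)[of j] by (intro mult_left_mono) auto
      then show ?thesis using U[OF x(1,3)] by simp
    qed
  qed
  then obtain C1 where C1: "C1 \<in> sets borel" "(\<Union>j. B1 j) \<subseteq> C1" "C1 \<subseteq> {1..}"
      "h_log_measure h C1 < \<infinity>" by blast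
  have "\<exists>C\<in>sets borel. (\<Union>j. B2 j) \<subseteq> C \<and> C \<subseteq> {1..} \<and> h_log_measure h C < \<infinity>"
  proof (rule summable_covers[OF \<open>summable G\<close> G_nonneg], rule cover)
    fix j show "B2 j \<subseteq> {R..}" by (auto simp: B2_def)
    show "y \<le> x * exp (\<delta> j)" if "x \<in> B2 j" "y \<in> B2 j" for x y
      using less[of "y * exp (- \<delta> j)" j x] that R by (auto simp: B2_def exp_minus field_simps)
    show "\<Phi> 0 \<le> real (n j) \<and> x \<le> U j" if "x \<in> B2 j" for x
    proof -
      define r where "r = x * exp (- \<delta> j)"
      have x: "x \<ge> R" "\<nu> r \<le> j" using that by (auto simp: B2_def r_def)
      have "R0 = R * exp (- b)" by (simp add: R_def exp_minus)
      also have "\<dots> \<le> r"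
        unfolding r_def using x R \<delta>(2)[of j] by (intro mult_mono) auto
      finally have "R0 \<le> r" .
      moreover have "r * exp (\<delta> j) = x"
        unfolding r_def mult.assoc mult_exp_exp by simp
      ultimately show ?thesis using U[of r j] x(2) by simp
    qed
  qed
  then obtain C2 where C2: "C2 \<in> sets borel" "(\<Union>j. B2 j) \<subseteq> C2" "C2 \<subseteq> {1..}"
      "h_log_measure h C2 < \<infinity>" by blast
  let ?M = "density (interval_measure (\<lambda>x. h (max 0 x))) (\<lambda>r. ennreal (1 / r))"
  have "emeasure ?M (C1 \<union> C2) \<le> emeasure ?M C1 + emeasure ?M C2"
    using C1(1) C2(1) by (intro emeasure_subadditive) auto
  also have "\<dots> < \<infinity>"
    using C1(1,4) C2(1,4) by (simp add: h_log_measure_eq_emeasure)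
  finally have fin: "h_log_measure h (C1 \<union> C2) < \<infinity>"
    using C1(1) C2(1) by (simp add: h_log_measure_eq_emeasure)
  have decay:
    "(\<forall>k>\<nu> r. T k r \<le> exp (- b) ^ (k - \<nu> r) * T (\<nu> r) r) \<and>
     (\<forall>k<\<nu> r. T k r \<le> exp (- b) ^ (\<nu> r - k) * T (\<nu> r) r)"
    if r: "r \<ge> R" "r \<notin> C1 \<union> C2" for r
  proof -
    have pos: "r > 0" using r R by simp
    have nB: "r \<notin> B1 j" "r \<notin> B2 j" for j
      using r(2) C1(2) C2(2) by blast+
    have e: "exp (- b) ^ i = exp (- b * real i)" for i
      by (simp add: exp_of_nat2_mult[symmetric])
    have "T k r \<le> exp (- b * (real k - real (\<nu> r))) * T (\<nu> r) r" if "k \<ge> \<nu> r" for k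
      by (rule term_decay_above[OF pos _ \<delta>(1) _ that])
        (use nB(1) r(1) \<delta>(3) in \<open>auto simp: B1_def not_less\<close>)
    moreover have "T k r \<le> exp (- b * (real (\<nu> r) - real k)) * T (\<nu> r) r" if "k \<le> \<nu> r" for k
      by (rule term_decay_below[OF pos _ \<delta>(1) _ that])
        (use nB(2) r(1) \<delta>(3) in \<open>auto simp: B2_def not_le\<close>)
    ultimately show ?thesis
      unfolding e by (auto simp: of_nat_diff less_imp_le)
  qed
  show ?thesis
    using C1(1,3) C2(1,3) fin R(2) decay by (intro exI[of _ "C1 \<union> C2"] exI[of _ R]) auto
qed

end

section \<open>Asymptotics outside the exceptional set\<close>

lemma geometric_tail_le_inverse:
  fixes N :: nat
  assumes "N > 0"
  shows "exp (- real N) / (1 - exp (- real N)) \<le> 1 / real N"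
proof -
  have "1 + real N \<le> exp (real N)" by (rule exp_ge_add_one_self)
  then show ?thesis using assms by (simp add: exp_minus field_simps)
qed

theorem corollary4p2:
  fixes \<Phi> h \<phi> :: "real \<Rightarrow> real"
    and n :: "nat \<Rightarrow> nat"
    and a :: "nat \<Rightarrow> complex"
    and f :: "complex \<Rightarrow> complex"
  assumes "\<Phi> \<in> class_L" and "h \<in> class_Lplus"
    and inverse: "\<forall>x\<ge>0. \<phi> (\<Phi> x) = x"
    and "strict_mono n"
    and entire: "\<forall>z. (\<lambda>k. a k * z ^ n k) sums f z"
    and growth: "\<exists>r0\<ge>1. \<forall>r\<ge>r0. ln (max_term a n r) \<ge> ln r * \<Phi> (ln r)"
    and gaps: "\<forall>b>0. summable (\<lambda>k.
      if \<Phi> 0 \<le> real (n k)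
      then 1 / (real (n (Suc k)) - real (n k)) *
           hl_deriv h (exp (\<phi> (real (n k)) + b / (real (n (Suc k)) - real (n k))))
      else 0)"
  shows "\<exists>E \<omega>. E \<in> sets borel \<and> E \<subseteq> {1..} \<and> h_log_measure h E < \<infinity> \<and>
    (\<forall>\<^sub>F r in inf at_top (principal (- E)). \<forall>\<theta>\<in>{0..2 * pi}.
       f (of_real r * exp (\<i> * of_real \<theta>)) =
         (1 + \<omega> r \<theta>) * a (central_index a n r) * of_real r ^ n (central_index a n r) *
           exp (\<i> * of_real \<theta> * of_nat (n (central_index a n r)))) \<and>
    uniform_limit {0..2 * pi} \<omega> (\<lambda>_. 0) (inf at_top (principal (- E)))"
proof -
  \<comment> \<open>For the zero series \<open>ln (max_term a n r) = ln 0 = 0\<close>, which is below the required growth.\<close>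
  have "\<exists>k. a k \<noteq> 0"
  proof (rule ccontr)
    assume "\<not> ?thesis"
    then have "max_term a n r = 0" for r
      unfolding max_term_def by (intro Greatest_equality) auto
    moreover obtain r0 where "r0 \<ge> 1" "\<And>r. r \<ge> r0 \<Longrightarrow> ln (max_term a n r) \<ge> ln r * \<Phi> (ln r)"
      using growth by blast
    ultimately have "ln (r0 + 1) * \<Phi> (ln (r0 + 1)) \<le> 0"
      by (metis less_add_one less_imp_le ln_0)
    moreover have "ln (r0 + 1) > 0" using \<open>r0 \<ge> 1\<close> by simp
    moreover from this have "\<Phi> (ln (r0 + 1)) > 0"
      using \<open>\<Phi> \<in> class_L\<close> by (simp add: class_L_def)
    ultimately show False by (simp add: mult_le_0_iff)
  qed
  moreover have "(\<lambda>k. norm (a k) * r ^ n k) \<longlonglongrightarrow> 0" if "r > 0" for r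
  proof -
    have "(\<lambda>k. a k * of_real r ^ n k) \<longlonglongrightarrow> 0"
      using entire by (intro summable_LIMSEQ_zero sums_summable) blast
    from tendsto_norm_zero[OF this] show ?thesis
      using that by (simp add: norm_mult norm_power)
  qed
  ultimately interpret gap_series a n
    using \<open>strict_mono n\<close> by unfold_locales auto

  define bnd where "bnd b r \<longleftrightarrow>
      (\<forall>k>\<nu> r. T k r \<le> exp (- b) ^ (k - \<nu> r) * T (\<nu> r) r) \<and>
      (\<forall>k<\<nu> r. T k r \<le> exp (- b) ^ (\<nu> r - k) * T (\<nu> r) r)" for b r
  have "\<exists>E R. E \<in> sets borel \<and> E \<subseteq> {1..} \<and> h_log_measure h E < \<infinity> \<and> 1 \<le> R \<and>
      (\<forall>r\<ge>R. r \<notin> E \<longrightarrow> bnd (real (Suc N)) r)" for N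
    unfolding bnd_def
    by (rule exceptional_set[OF \<open>\<Phi> \<in> class_L\<close> \<open>h \<in> class_Lplus\<close> inverse growth])
      (use gaps in auto)
  then obtain E R0 where E: "\<And>N. E N \<in> sets borel" "\<And>N. E N \<subseteq> {1..}"
      "\<And>N. h_log_measure h (E N) < \<infinity>"
    and R0: "\<And>N. 1 \<le> R0 N" "\<And>N r. r \<ge> R0 N \<Longrightarrow> r \<notin> E N \<Longrightarrow> bnd (real (Suc N)) r"
    by metis
  let ?M = "density (interval_measure (\<lambda>x. h (max 0 x))) (\<lambda>r. ennreal (1 / r))"
  \<comment> \<open>The sets \<open>E N\<close> belong to the rates of decay \<open>Suc N\<close>; only their tails are kept.\<close>
  have "emeasure ?M (E N) < \<infinity>" for N
    using E(1,3) by (simp add: h_log_measure_eq_emeasure)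
  then obtain R where R: "\<And>N. R0 N \<le> R N" "emeasure ?M (\<Union>N. E N \<inter> {R N..}) < \<infinity>"
    using union_of_tails_finite_measure[of ?M E R0] E(1) by auto
  define F where "F = (\<Union>N. E N \<inter> {R N..})"
  have F: "F \<in> sets borel" "F \<subseteq> {1..}"
    using E(1,2) unfolding F_def by (auto intro!: sets.countable_UN)
  have F_fin: "h_log_measure h F < \<infinity>"
    using R(2) F(1) by (simp add: h_log_measure_eq_emeasure F_def)
  define lead where "lead r \<theta> = a (\<nu> r) * of_real r ^ n (\<nu> r) *
      exp (\<i> * of_real \<theta> * of_nat (n (\<nu> r)))" for r \<theta> :: real
  define \<omega> where "\<omega> r \<theta> = f (of_real r * exp (\<i> * of_real \<theta>)) / lead r \<theta> - 1" for r \<theta>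
  have norm_lead: "norm (lead r \<theta>) = T (\<nu> r) r" if "r > 0" for r \<theta>
    using that by (simp add: lead_def norm_mult norm_power norm_exp_eq_Re)
  have lead_nz: "lead r \<theta> \<noteq> 0" if "r > 0" for r \<theta>
    using central_pos[OF that] unfolding norm_lead[OF that, of \<theta>, symmetric]
    by (simp only: zero_less_norm_iff not_False_eq_True)
  have \<omega>_le: "norm (\<omega> r \<theta>) \<le> 2 / real (Suc N)" if r: "r \<ge> R N" "r \<notin> F" for r \<theta> N
  proof -
    define z where "z = of_real r * exp (\<i> * of_real \<theta>)"
    define q where "q = exp (- real (Suc N))"
    have pos: "r > 0" using r(1) R(1)[of N] R0(1)[of N] by linarith
    have "r \<notin> E N" using r by (auto simp: F_def)
    then have bnd: "bnd (real (Suc N)) r"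
      using R0(2)[of N r] R(1)[of N] r(1) by simp
    have nz: "norm (a k * z ^ n k) = T k r" for k
      using pos by (simp add: z_def norm_mult norm_power norm_exp_eq_Re)
    have lead_eq: "a (\<nu> r) * z ^ n (\<nu> r) = lead r \<theta>"
      by (simp add: z_def lead_def power_mult_distrib exp_of_nat2_mult[symmetric] mult.assoc)
    have "norm (f z - a (\<nu> r) * z ^ n (\<nu> r)) \<le> 2 * (q / (1 - q) * T (\<nu> r) r)"
    proof (rule sums_two_sided_geometric_le[where u = "\<lambda>k. a k * z ^ n k" and m = "\<nu> r"])
      show "(\<lambda>k. a k * z ^ n k) sums f z" using entire by blast
    qed (use bnd central_pos[OF pos] in \<open>auto simp: q_def bnd_def nz\<close>)
    also have "\<dots> \<le> 2 * (1 / real (Suc N) * T (\<nu> r) r)"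
      unfolding q_def using geometric_tail_le_inverse[of "Suc N"] central_pos[OF pos]
      by (intro mult_left_mono mult_right_mono) auto
    finally have "norm (f z - lead r \<theta>) \<le> 2 / real (Suc N) * norm (lead r \<theta>)"
      by (simp add: lead_eq norm_lead[OF pos])
    moreover have "\<omega> r \<theta> = (f z - lead r \<theta>) / lead r \<theta>"
      using lead_nz[OF pos] by (simp add: \<omega>_def z_def diff_divide_distrib)
    ultimately show ?thesis
      using lead_nz[OF pos, of \<theta>] by (simp add: norm_divide pos_divide_le_eq)
  qed
  have "\<forall>\<^sub>F r in inf at_top (principal (- F)). \<forall>\<theta>\<in>{0..2 * pi}.
       f (of_real r * exp (\<i> * of_real \<theta>)) =
         (1 + \<omega> r \<theta>) * a (\<nu> r) * of_real r ^ n (\<nu> r) *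
           exp (\<i> * of_real \<theta> * of_nat (n (\<nu> r)))"
    unfolding eventually_inf_principal
    using eventually_gt_at_top[of "0 :: real"]
  proof eventually_elim
    case (elim r)
    have "f (of_real r * exp (\<i> * of_real \<theta>)) = (1 + \<omega> r \<theta>) * lead r \<theta>" for \<theta>
      using lead_nz[OF elim, of \<theta>] by (simp add: \<omega>_def)
    then show ?case by (simp add: lead_def mult.assoc)
  qed
  moreover have "uniform_limit {0..2 * pi} \<omega> (\<lambda>_. 0) (inf at_top (principal (- F)))"
  proof (rule uniform_limitI)
    fix e :: real assume "e > 0"
    then obtain N where N: "2 / e < real (Suc N)"
      using reals_Archimedean2[of "2 / e"] by (metis less_trans lessI of_nat_less_iff)
    then have "2 / real (Suc N) < e"
      using \<open>e > 0\<close> by (simp add: field_simps)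
    then have "\<forall>\<theta>\<in>{0..2 * pi}. dist (\<omega> r \<theta>) 0 < e" if "r \<ge> R N" "r \<notin> F" for r
      using \<omega>_le[OF that] by (auto intro: le_less_trans)
    then show "\<forall>\<^sub>F r in inf at_top (principal (- F)). \<forall>\<theta>\<in>{0..2 * pi}. dist (\<omega> r \<theta>) 0 < e"
      unfolding eventually_inf_principal
      by (auto intro: eventually_mono[OF eventually_ge_at_top[of "R N"]])
  qed
  ultimately show ?thesis
    using F F_fin by blast
qed

end
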